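(* Let $T_j=\frac{j(j+1)}{2}$ for integers $j\ge 0$. (i) Let $n\ge 2$ be an integer such that $n\ne T_j$ for all $j\ge 0$. Then $$\sum_{\substack{j\in\mathbb{Z}\\ 2j^2+2\le n}}DE_e(n-2j^2-2)\equiv\sum_{\substack{j\in\mathbb{Z}\\ 2j^2+2\le n}}DE_e(n-2j^2+1)\pmod 2.$$ (ii) Let $n\ge 0$ be an integer such that $n\ne T_j$ for all $j\ge 0$. Then $$\sum_{\substack{j\in\mathbb{Z}\\ 2j^2\le n}}DE_{e1}(n-2j^2+1)\equiv\sum_{\substack{j\in\mathbb{Z}\\ 2j^2\le n}}DE_{e1}(n-2j^2)\pmod 2.$$
   Context: Notation: $(\alpha;q)_0=1$, $(\alpha;q)_n=\prod_{j=0}^{n-1}(1-\alpha q^j)$, $|q|<1$. The numbers $DE_e(n)$, $n\ge 0$, are defined by the generating function $\sum_{n\ge 0}DE_e(n)q^n=\sum_{n\ge 0}\frac{(-q^2;q^2)_n\,q^{2n}}{(q;q^2)_n}$. $DE_{e1}(n)$ is the number of partitions of $n$ in which no even part is repeated and the largest part is even and appears exactly once; its generating function is $\sum_{n\ge0}DE_{e1}(n)q^n=\sum_{n\ge 0}\frac{(-q^2;q^2)_n\,q^{2n+2}}{(q;q^2)_{n+1}}$. *)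

theory Defs
  imports
    "HOL-Computational_Algebra.Formal_Power_Series"
    "HOL-Library.Multiset"
    "HOL-Library.Nat_Bijection"
    "HOL-Number_Theory.Cong"
begin

definition qpoch :: "'a::comm_ring_1 fps \<Rightarrow> 'a fps \<Rightarrow> nat \<Rightarrow> 'a fps" where
  "qpoch a q n = (\<Prod>j<n. 1 - a * q ^ j)"

(* Working over the integers keeps congruences of coefficients meaningful.
   There fps_right_inverse D 1 is the reciprocal of a series D with constant term 1. *)
definition DE_e_summand :: "nat \<Rightarrow> int fps" where
  "DE_e_summand n =
     qpoch (- (fps_X ^ 2)) (fps_X ^ 2) n * fps_X ^ (2 * n)
       * fps_right_inverse (qpoch fps_X (fps_X ^ 2) n) 1"

definition DE_e :: "nat \<Rightarrow> int" where
  "DE_e m = fps_nth (\<Sum>n. DE_e_summand n) m"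

definition is_partition :: "nat multiset \<Rightarrow> nat \<Rightarrow> bool" where
  "is_partition P n \<longleftrightarrow> 0 \<notin># P \<and> sum_mset P = n"

(* The empty partition has no largest part and is not counted, so DE_e1 0 = 0. *)
definition DE_e1_partitions :: "nat \<Rightarrow> nat multiset set" where
  "DE_e1_partitions n =
     {P. is_partition P n \<and>
         (\<forall>k. even k \<longrightarrow> count P k \<le> 1) \<and>
         P \<noteq> {#} \<and> even (Max_mset P) \<and> count P (Max_mset P) = 1}"

definition DE_e1 :: "nat \<Rightarrow> nat" where
  "DE_e1 n = card (DE_e1_partitions n)"

lemma qpoch_odd_inverse:
  "qpoch fps_X (fps_X ^ 2) n * fps_right_inverse (qpoch fps_X (fps_X ^ 2) n) (1::int) = 1"
proof (rule fps_right_inverse)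
  show "fps_nth (qpoch fps_X (fps_X ^ 2) n) 0 * (1::int) = 1"
    by (induction n) (auto simp: qpoch_def fps_mult_nth_0)
qed

lemma DE_e_summand_nth_eq_0:
  assumes "m < 2 * n"
  shows "fps_nth (DE_e_summand n) m = 0"
proof -
  have "DE_e_summand n = fps_X ^ (2 * n) *
    (qpoch (- (fps_X ^ 2)) (fps_X ^ 2) n * fps_right_inverse (qpoch fps_X (fps_X ^ 2) n) 1)"
    unfolding DE_e_summand_def by (simp only: mult_ac)
  then show ?thesis
    using assms by (simp add: fps_X_power_mult_nth)
qed

lemma DE_e_summand_sums:
  "DE_e_summand sums Abs_fps (\<lambda>m. \<Sum>n\<le>m. fps_nth (DE_e_summand n) m)"
  unfolding sums_def
proof (rule tendsto_fpsI)
  fix m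
  show "eventually (\<lambda>N. fps_nth (\<Sum>n<N. DE_e_summand n) m =
          fps_nth (Abs_fps (\<lambda>m. \<Sum>n\<le>m. fps_nth (DE_e_summand n) m)) m) sequentially"
    using eventually_gt_at_top[of m]
  proof eventually_elim
    case (elim N)
    have "(\<Sum>n<N. fps_nth (DE_e_summand n) m) = (\<Sum>n\<le>m. fps_nth (DE_e_summand n) m)"
      using elim by (intro sum.mono_neutral_right) (auto intro!: DE_e_summand_nth_eq_0)
    then show ?case
      by (simp add: fps_sum_nth)
  qed
qed

lemma DE_e_generating_function: "DE_e_summand sums Abs_fps DE_e"
proof -
  have "Abs_fps DE_e = suminf DE_e_summand"
    by (rule fps_ext) (simp add: DE_e_def)
  with DE_e_summand_sums show ?thesis
    by (simp add: sums_iff)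
qed

lemma finite_DE_e1_partitions: "finite (DE_e1_partitions n)"
proof (rule finite_subset)
  show "DE_e1_partitions n \<subseteq> mset ` {xs. set xs \<subseteq> {..n} \<and> length xs \<le> n}"
  proof
    fix P assume "P \<in> DE_e1_partitions n"
    then have P: "0 \<notin># P" "sum_mset P = n"
      by (auto simp: DE_e1_partitions_def is_partition_def)
    obtain xs where xs: "P = mset xs"
      by (metis ex_mset)
    have "length ys \<le> sum_list ys" if "0 \<notin> set ys" for ys :: "nat list"
      using that by (induction ys) auto
    with P xs have "length xs \<le> n"
      by (auto simp: sum_mset_sum_list)
    moreover have "set xs \<subseteq> {..n}"
      using P xs by (auto simp: sum_mset_sum_list intro: member_le_sum_list)
    ultimately show "P \<in> mset ` {xs. set xs \<subseteq> {..n} \<and> length xs \<le> n}"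
      using xs by blast
  qed
  show "finite (mset ` {xs. set xs \<subseteq> {..n} \<and> length xs \<le> n})"
    by (intro finite_imageI finite_lists_length_le) simp
qed

end

theory Submission
  imports Defs
begin

text \<open>
  Modulo 2 the terms for \<open>j\<close> and \<open>-j\<close> cancel, so only \<open>j = 0\<close> survives in each sum: this is the
  congruence \<open>\<Sum>j. q^(2 j^2) \<equiv> 1\<close>. What remains is that \<open>DE_e (n + 1) - DE_e (n - 2)\<close> and
  \<open>DE_e1 (n + 1) - DE_e1 n\<close> are even whenever \<open>n\<close> is not triangular.

  Put \<open>A n = (q^2;q^2)_n / (q;q^2)_n\<close>, which is \<open>gauss_prod n\<close> below. Since \<open>-1 \<equiv> 1\<close>, the two
  generating functions are congruent to \<open>\<Sum>n. A n * q^(2n)\<close> and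
  \<open>\<Sum>n. A n * q^(2n+2) / (1 - q^(2n+1))\<close>. Multiplied by \<open>1 - q^3\<close> and by \<open>1 - q\<close> respectively, both
  sums telescope (\<open>telescoping_sum_DE_e\<close>, \<open>telescoping_sum_DE_e1\<close>), and up to terms of low degree
  both become \<open>q * A \<infinity>\<close>. So either difference is congruent to the coefficient of \<open>q^n\<close>
  in \<open>A \<infinity>\<close>. By Gauss's identity \<open>A \<infinity> = \<Sum>j. q^(j(j+1)/2)\<close>, and this coefficient
  vanishes unless \<open>n\<close> is triangular.

  No infinite product is formed. Gauss's identity is replaced by the finite identity of Shanks
  (\<open>shanks_identity\<close>), which determines the coefficients of \<open>A K\<close> below degree \<open>2 K + 1\<close>, and every
  generating function is truncated at a degree beyond the coefficient in question.

  For \<open>DE_e1\<close> the generating function has to be derived from the partitions. Removing the largest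
  part \<open>2 k + 2\<close> leaves a partition with parts at most \<open>2 k + 1\<close> and distinct even parts, and these
  are counted by admitting the part sizes one at a time (\<open>bounded_gf_Suc\<close>).
\<close>

unbundle fps_syntax

section \<open>Symmetric sums modulo 2\<close>

lemma sum_symmetric_even_function:
  fixes f :: "int \<Rightarrow> 'a::comm_semiring_1"
  assumes "finite S" "0 \<in> S" "\<And>j. j \<in> S \<Longrightarrow> - j \<in> S" "\<And>j. f (- j) = f j"
  obtains c where "sum f S = f 0 + 2 * c"
proof -
  have split: "S = insert 0 ({j \<in> S. j > 0} \<union> {j \<in> S. j < 0})"
    using assms(2) by auto
  have disj: "sum f ({j \<in> S. j > 0} \<union> {j \<in> S. j < 0}) = sum f {j \<in> S. j > 0} + sum f {j \<in> S. j < 0}"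
    using assms(1) by (intro sum.union_disjoint) auto
  have "sum f {j \<in> S. j < 0} = sum f {j \<in> S. j > 0}"
    using assms(3) by (intro sum.reindex_bij_witness[of _ uminus uminus]) (auto simp: assms(4))
  moreover have "sum f S = f 0 + (sum f {j \<in> S. j > 0} + sum f {j \<in> S. j < 0})"
    using assms(1) by (subst split, subst sum.insert) (auto simp: disj)
  ultimately have "sum f S = f 0 + 2 * sum f {j \<in> S. j > 0}"
    by (simp add: mult_2)
  then show ?thesis by (rule that)
qed

lemma finite_int_double_square_le: "finite {j::int. 2 * j\<^sup>2 + c \<le> m}"
proof (rule finite_subset)
  show "{j::int. 2 * j\<^sup>2 + c \<le> m} \<subseteq> {- \<bar>m - c\<bar>..\<bar>m - c\<bar>}"
  proof
    fix j assume "j \<in> {j::int. 2 * j\<^sup>2 + c \<le> m}"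
    moreover have "\<bar>j\<bar> \<le> j\<^sup>2"
      using self_le_power[of "\<bar>j\<bar>" 2] by (cases "j = 0") auto
    ultimately show "j \<in> {- \<bar>m - c\<bar>..\<bar>m - c\<bar>}" by auto
  qed
qed simp

section \<open>Shanks's finite form of Gauss's triangular number identity\<close>

text \<open>
  The factor \<open>i k\<close> stands for \<open>1 / (1 - x^(2k+1))\<close>, so the product of \<open>r\<close> over \<open>{s..<n}\<close> is the quotient
  \<open>A n / A s\<close> with \<open>A n = (x^2;x^2)_n / (x;x^2)_n\<close>. When \<open>n\<close> grows by one, the change of the summand
  with index \<open>s\<close> is \<open>u (s + 1) - u s\<close>, where \<open>u m\<close> is the right-hand side below, and \<open>u 0 = 0\<close>.
\<close>
lemma shanks_difference_telescopes:
  fixes x :: "'a::comm_ring_1"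
  assumes inv: "\<And>k. (1 - x ^ (2 * k + 1)) * i k = 1"
  defines "r \<equiv> \<lambda>k. (1 - x ^ (2 * k + 2)) * i k"
  assumes "m \<le> n"
  shows "(\<Sum>s<m. (\<Prod>k=s..<Suc n. r k) * x ^ (s * (2 * n + 3)) -
                 (\<Prod>k=s..<n. r k) * x ^ (s * (2 * n + 1)))
         = i n * (\<Prod>k=m..<n. r k) * (1 - x ^ (2 * m)) * x ^ (m * (2 * n + 1))"
  using \<open>m \<le> n\<close>
proof (induction m)
  case 0
  then show ?case by simp
next
  case (Suc m)
  define p where "p = (\<Prod>k=m..<n. r k)"
  define p' where "p' = (\<Prod>k=Suc m..<n. r k)"
  define y where "y = x ^ (m * (2 * n + 1))"
  have p_Suc: "(\<Prod>k=m..<Suc n. r k) = p * r n"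
    using Suc.prems by (simp add: p_def)
  have p: "p = r m * p'"
    using Suc.prems by (simp add: p_def p'_def prod.atLeast_Suc_lessThan)
  have "p' * (1 - x ^ (2 * m + 2)) = p' * (1 - x ^ (2 * m + 2)) * ((1 - x ^ (2 * m + 1)) * i m)"
    by (simp only: inv mult_1_right)
  also have "\<dots> = p * (1 - x ^ (2 * m + 1))"
    by (simp add: p r_def mult_ac)
  finally have p': "p' * (1 - x ^ (2 * m + 2)) = p * (1 - x ^ (2 * m + 1))" .
  have exps: "x ^ (m * (2 * n + 3)) = y * x ^ (2 * m)"
             "x ^ (Suc m * (2 * n + 1)) = y * x ^ (2 * n + 1)"
    unfolding y_def power_add[symmetric] by (auto intro!: arg_cong[of _ _ "power x"] simp: algebra_simps)
  have prods: "x ^ (2 * n + 1) * x ^ (2 * m + 1) = x ^ (2 * m) * x ^ (2 * n + 2)"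
    unfolding power_add[symmetric] by (simp add: add.commute)
  \<comment> \<open>The factor \<open>1 = (1 - x^(2n+1)) * i n\<close> puts both terms over the denominator of \<open>r n\<close>.\<close>
  have "(p * r n) * (y * x ^ (2 * m)) - p * y
        = (p * r n) * (y * x ^ (2 * m)) - p * y * ((1 - x ^ (2 * n + 1)) * i n)"
    by (simp only: inv mult_1_right)
  also have "\<dots> = i n * p * y * (x ^ (2 * m) - x ^ (2 * m) * x ^ (2 * n + 2) - 1 + x ^ (2 * n + 1))"
    unfolding r_def by (simp only: algebra_simps mult_1_left mult_1_right)
  also have "\<dots> = i n * p * y * (x ^ (2 * n + 1) * (1 - x ^ (2 * m + 1)) - (1 - x ^ (2 * m)))"
    unfolding prods[symmetric] by (simp only: algebra_simps mult_1_left mult_1_right)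
  also have "\<dots> = i n * (p * (1 - x ^ (2 * m + 1))) * (y * x ^ (2 * n + 1))
                  - i n * p * (1 - x ^ (2 * m)) * y"
    by (simp only: algebra_simps mult_1_left mult_1_right)
  finally have step: "(p * r n) * (y * x ^ (2 * m)) - p * y = \<dots>" .
  have IH: "(\<Sum>s<m. (\<Prod>k=s..<Suc n. r k) * x ^ (s * (2 * n + 3)) -
                 (\<Prod>k=s..<n. r k) * x ^ (s * (2 * n + 1))) = i n * p * (1 - x ^ (2 * m)) * y"
    unfolding p_def y_def using Suc.prems by (intro Suc.IH) simp
  have two: "2 * Suc m = 2 * m + 2" by simp
  show ?case
    unfolding sum.lessThan_Suc IH p_Suc exps p_def[symmetric] y_def[symmetric] step
      p'_def[symmetric] two p'[symmetric]
    by (simp add: mult.assoc)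
qed

text \<open>
  By induction on \<open>n\<close>: the telescoping sum and the new summand \<open>s = n\<close> together contribute
  \<open>x^(n(2n+1)) * (1 + x^(2n+1))\<close>, the two powers of \<open>x\<close> with the exponents \<open>triangle (2n)\<close> and
  \<open>triangle (2n+1)\<close>. Modulo \<open>x^(2n+1)\<close> only the summand \<open>s = 0\<close> is left on the left-hand side, and
  \<open>n \<rightarrow> \<infinity>\<close> gives Gauss's identity.
\<close>
theorem shanks_identity:
  fixes x :: "'a::comm_ring_1"
  assumes inv: "\<And>k. (1 - x ^ (2 * k + 1)) * i k = 1"
  shows "(\<Sum>s<n. (\<Prod>k=s..<n. (1 - x ^ (2 * k + 2)) * i k) * x ^ (s * (2 * n + 1)))
         = (\<Sum>s<2 * n. x ^ triangle s)"
proof (induction n)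
  case 0
  then show ?case by simp
next
  case (Suc n)
  define r where "r = (\<lambda>k. (1 - x ^ (2 * k + 2)) * i k)"
  define y where "y = x ^ (n * (2 * n + 1))"
  have tri: "triangle (2 * n) = n * (2 * n + 1)"
            "triangle (Suc (2 * n)) = n * (2 * n + 1) + (2 * n + 1)"
    by (simp_all add: triangle_def algebra_simps)
  have three: "2 * Suc n + 1 = 2 * n + 3" by simp
  have two: "2 * Suc n = Suc (Suc (2 * n))" by simp
  have "(\<Sum>s<Suc n. (\<Prod>k=s..<Suc n. r k) * x ^ (s * (2 * Suc n + 1)))
        = (\<Sum>s<n. (\<Prod>k=s..<n. r k) * x ^ (s * (2 * n + 1)))
          + (\<Sum>s<n. (\<Prod>k=s..<Suc n. r k) * x ^ (s * (2 * n + 3)) -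
                 (\<Prod>k=s..<n. r k) * x ^ (s * (2 * n + 1)))
          + r n * x ^ (n * (2 * n + 3))"
    unfolding three sum_subtractf sum.lessThan_Suc by simp
  also have "(\<Sum>s<n. (\<Prod>k=s..<Suc n. r k) * x ^ (s * (2 * n + 3)) -
                 (\<Prod>k=s..<n. r k) * x ^ (s * (2 * n + 1))) = i n * (1 - x ^ (2 * n)) * y"
    using shanks_difference_telescopes[OF inv, of n n] by (simp add: r_def y_def)
  also have "x ^ (n * (2 * n + 3)) = y * x ^ (2 * n)"
    unfolding y_def power_add[symmetric] by (auto intro!: arg_cong[of _ _ "power x"] simp: algebra_simps)
  also have "(\<Sum>s<n. (\<Prod>k=s..<n. r k) * x ^ (s * (2 * n + 1))) = (\<Sum>s<2 * n. x ^ triangle s)"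
    using Suc.IH by (simp add: r_def)
  also have "(\<Sum>s<2 * n. x ^ triangle s) + i n * (1 - x ^ (2 * n)) * y + r n * (y * x ^ (2 * n))
       = (\<Sum>s<2 * n. x ^ triangle s) + y * ((1 + x ^ (2 * n + 1)) * ((1 - x ^ (2 * n + 1)) * i n))"
  proof -
    have e: "x ^ (2 * n) * x ^ (2 * n + 2) = x ^ (2 * n + 1) * x ^ (2 * n + 1)"
      unfolding power_add[symmetric] by (auto intro!: arg_cong[of _ _ "power x"])
    have "i n * (1 - x ^ (2 * n)) * y + r n * (y * x ^ (2 * n))
          = i n * y * (1 - x ^ (2 * n) * x ^ (2 * n + 2))"
      unfolding r_def by (simp only: algebra_simps mult_1_left mult_1_right)
    also have "\<dots> = y * ((1 + x ^ (2 * n + 1)) * ((1 - x ^ (2 * n + 1)) * i n))"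
      unfolding e by (simp only: algebra_simps mult_1_left mult_1_right)
    finally show ?thesis by (simp only: add.assoc)
  qed
  also have "\<dots> = (\<Sum>s<2 * Suc n. x ^ triangle s)"
    unfolding inv mult_1_right two sum.lessThan_Suc tri power_add[of x "n * (2 * n + 1)"] y_def[symmetric]
    by (simp only: distrib_left mult_1_right add.assoc)
  finally show ?case
    by (simp add: r_def)
qed

section \<open>Gauss's product and the two telescoping sums\<close>

definition odd_inv :: "nat \<Rightarrow> int fps" where
  "odd_inv k = fps_right_inverse (1 - fps_X ^ (2 * k + 1)) 1"

lemma odd_inv: "(1 - fps_X ^ (2 * k + 1)) * odd_inv k = 1"
  unfolding odd_inv_def by (rule fps_right_inverse) simp

text \<open>
  The quotient \<open>(q^2;q^2)_n / (q;q^2)_n\<close>, kept as a product of ratios to match \<open>shanks_identity\<close>.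
\<close>
definition gauss_prod :: "nat \<Rightarrow> int fps" where
  "gauss_prod n = (\<Prod>k<n. (1 - fps_X ^ (2 * k + 2)) * odd_inv k)"

text \<open>
  In Shanks's identity the summands with \<open>s > 0\<close> start at degree \<open>2 K + 1\<close> or later, so below this
  degree the product agrees with a sum of triangular powers.
\<close>
lemma gauss_prod_nth_non_triangular:
  assumes "n < 2 * K + 1" and "\<And>j. n \<noteq> triangle j"
  shows "gauss_prod K $ n = 0"
proof -
  have "K > 0" using assms(1) assms(2)[of 0] by simp
  define t where "t = (\<lambda>s. (\<Prod>k=s..<K. (1 - fps_X ^ (2 * k + 2)) * odd_inv k) *
                            fps_X ^ (s * (2 * K + 1)))"
  have "t s $ n = 0" if "s > 0" for s
  proof -
    have "1 * (2 * K + 1) \<le> s * (2 * K + 1)" using that by (intro mult_right_mono) auto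
    with assms(1) have "n < s * (2 * K + 1)" by (simp only: mult_1_left less_le_trans)
    then show ?thesis by (simp add: t_def fps_X_power_mult_right_nth)
  qed
  then have "(\<Sum>s<K. t s) $ n = (\<Sum>s\<in>{0}. t s $ n)"
    using \<open>K > 0\<close> unfolding fps_sum_nth by (intro sum.mono_neutral_right) auto
  also have "\<dots> = gauss_prod K $ n"
    by (simp add: t_def gauss_prod_def lessThan_atLeast0)
  finally have "(\<Sum>s<K. t s) $ n = gauss_prod K $ n" .
  then have "gauss_prod K $ n = (\<Sum>s<2 * K. fps_X ^ triangle s :: int fps) $ n"
    unfolding t_def shanks_identity[OF odd_inv] by (rule sym)
  also have "\<dots> = 0"
    using assms(2) by (simp add: fps_sum_nth)
  finally show ?thesis .
qed

text \<open>
  The summands are the successive differences of \<open>q * A k\<close>, because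
  \<open>(1 - q^(2k+2)) - (1 - q^(2k+1)) = q^(2k+1) * (1 - q)\<close>.
\<close>
lemma telescoping_sum_DE_e1:
  "(1 - fps_X) * (\<Sum>k<K. fps_X ^ (2 * k + 2) * (gauss_prod k * odd_inv k))
   = fps_X * (gauss_prod K - 1)"
proof (induction K)
  case 0
  then show ?case by (simp add: gauss_prod_def)
next
  case (Suc K)
  define w where "w = (fps_X ^ (2 * K + 1) :: int fps)"
  have w: "fps_X ^ (2 * K + 2) = fps_X * w" by (simp add: w_def)
  have "fps_X * (gauss_prod (Suc K) - 1)
        = fps_X * (gauss_prod K * ((1 - fps_X * w) * odd_inv K) - 1)"
    by (simp add: gauss_prod_def flip: w)
  also have "\<dots> = fps_X * (gauss_prod K * ((1 - w) * odd_inv K) - 1)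
                  + (1 - fps_X) * (fps_X * w * (gauss_prod K * odd_inv K))"
    by (simp only: algebra_simps mult_1_left mult_1_right)
  also have "(1 - w) * odd_inv K = 1"
    unfolding w_def by (rule odd_inv)
  finally show ?case
    using Suc.IH unfolding sum.lessThan_Suc w by (simp only: distrib_left mult_1_right)
qed

text \<open>
  The sequence being differenced is \<open>(q - q^(2k)) * A k\<close>, that is \<open>q * (q^2;q^2)_k / (q;q^2)_(k-1)\<close>
  with the denominator \<open>(q;q^2)_(-1)\<close> read as \<open>1 / (1 - 1/q)\<close>; its value \<open>q - 1\<close> at \<open>k = 0\<close> is the
  source of the last two terms.
\<close>
lemma telescoping_sum_DE_e:
  "(1 - fps_X ^ 3) * (\<Sum>k<K. fps_X ^ (2 * k) * gauss_prod k)
   = (fps_X - fps_X ^ (2 * K)) * gauss_prod K + 1 - fps_X"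
proof (induction K)
  case 0
  then show ?case by (simp add: gauss_prod_def)
next
  case (Suc K)
  define w where "w = (fps_X ^ (2 * K + 1) :: int fps)"
  have w: "fps_X ^ (2 * K + 2) = fps_X * w" "2 * Suc K = 2 * K + 2" by (simp_all add: w_def)
  have w': "fps_X ^ 3 * fps_X ^ (2 * K) = fps_X * (fps_X * w)"
    by (simp add: w_def numeral_3_eq_3 mult_ac)
  have "(fps_X - fps_X ^ (2 * Suc K)) * gauss_prod (Suc K)
        = (fps_X - fps_X * w) * (gauss_prod K * ((1 - fps_X * w) * odd_inv K))"
    by (simp only: gauss_prod_def prod.lessThan_Suc w)
  also have "\<dots> = fps_X * gauss_prod K * (1 - fps_X * w) * ((1 - w) * odd_inv K)"
    by (simp only: algebra_simps mult_1_left mult_1_right)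
  also have "\<dots> = fps_X * gauss_prod K - fps_X ^ 3 * fps_X ^ (2 * K) * gauss_prod K"
    unfolding w_def odd_inv unfolding w_def[symmetric] w' by (simp only: algebra_simps mult_1_left mult_1_right)
  finally have last: "(fps_X - fps_X ^ (2 * Suc K)) * gauss_prod (Suc K) = \<dots>" .
  show ?case
    unfolding sum.lessThan_Suc distrib_left Suc.IH last by (simp only: algebra_simps mult_1_left mult_1_right)
qed

section \<open>The generating function of DE_e modulo 2\<close>

lemma even_fps_nth:
  assumes "2 dvd (f :: int fps)"
  shows "2 dvd f $ n"
proof -
  obtain g where "f = 2 * g" using assms by (elim dvdE)
  then have "f $ n = g $ n + g $ n" by (simp only: mult_2 fps_add_nth)
  then show ?thesis by (simp only: mult_2[symmetric] dvd_triv_left)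
qed

text \<open>
  This replaces \<open>(-q^2;q^2)_n\<close> by \<open>(q^2;q^2)_n\<close>, which makes the sums telescope.
\<close>
lemma qpoch_sign_mod_2:
  "2 dvd qpoch (- a) q n - qpoch (a :: int fps) q n"
proof (induction n)
  case (Suc n)
  have "qpoch (- a) q (Suc n) - qpoch a q (Suc n)
        = (qpoch (- a) q n - qpoch a q n) * (1 - a * q ^ n) + 2 * (qpoch (- a) q n * a * q ^ n)"
    by (simp add: qpoch_def algebra_simps)
  with Suc.IH show ?case by (simp add: dvd_add)
qed (simp add: qpoch_def)

lemma qpoch_odd_times_inv: "qpoch fps_X (fps_X ^ 2) n * (\<Prod>k<n. odd_inv k) = 1"
proof -
  have "qpoch fps_X (fps_X ^ 2) n * (\<Prod>k<n. odd_inv k)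
        = (\<Prod>k<n. (1 - fps_X ^ (2 * k + 1)) * odd_inv k)"
    by (simp add: qpoch_def prod.distrib power_mult)
  then show ?thesis by (simp only: odd_inv prod.neutral_const)
qed

lemma right_inverse_qpoch_odd:
  "fps_right_inverse (qpoch fps_X (fps_X ^ 2) n) 1 = (\<Prod>k<n. odd_inv k)"
  (is "?R = ?I")
proof -
  let ?Q = "qpoch fps_X (fps_X ^ 2) n :: int fps"
  have "?R = ?R * (?Q * ?I)" by (simp only: qpoch_odd_times_inv mult_1_right)
  also have "\<dots> = (?Q * ?R) * ?I" by (simp only: mult_ac)
  finally show ?thesis by (simp only: qpoch_odd_inverse mult_1_left)
qed

lemma gauss_prod_qpoch:
  "gauss_prod n = qpoch (fps_X ^ 2) (fps_X ^ 2) n * (\<Prod>k<n. odd_inv k)"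
proof -
  have "fps_X ^ (2 * k + 2) = fps_X ^ 2 * (fps_X ^ 2 :: int fps) ^ k" for k
    unfolding power_add power_mult by (rule mult.commute)
  then show ?thesis
    by (simp only: gauss_prod_def qpoch_def prod.distrib)
qed

lemma DE_e_summand_mod_2: "2 dvd DE_e_summand n - fps_X ^ (2 * n) * gauss_prod n"
proof -
  have "DE_e_summand n - fps_X ^ (2 * n) * gauss_prod n
     = (qpoch (- (fps_X ^ 2)) (fps_X ^ 2) n - qpoch (fps_X ^ 2) (fps_X ^ 2) n)
         * (fps_X ^ (2 * n) * (\<Prod>k<n. odd_inv k))"
    by (simp add: DE_e_summand_def right_inverse_qpoch_odd gauss_prod_qpoch algebra_simps)
  then show ?thesis using qpoch_sign_mod_2 by simp
qed

lemma DE_e_eq_partial_sum: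
  assumes "m < K"
  shows "DE_e m = (\<Sum>n<K. DE_e_summand n) $ m"
proof -
  have "Abs_fps DE_e = Abs_fps (\<lambda>m. \<Sum>n\<le>m. DE_e_summand n $ m)"
    using DE_e_generating_function DE_e_summand_sums by (rule sums_unique2)
  then have "DE_e m = (\<Sum>n\<le>m. DE_e_summand n $ m)"
    by (metis fps_nth_Abs_fps)
  also have "\<dots> = (\<Sum>n<K. DE_e_summand n $ m)"
    using assms by (intro sum.mono_neutral_left) (auto intro!: DE_e_summand_nth_eq_0)
  finally show ?thesis by (simp add: fps_sum_nth)
qed

text \<open>
  The coefficient of \<open>q^(n+1)\<close> in \<open>(1 - q^3) * \<Sum>m. DE_e m * q^m\<close>. The polynomial \<open>1 - q\<close> in the
  telescoped sum is invisible there because \<open>n + 1 > 1\<close>.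
\<close>
lemma DE_e_shift_mod_2:
  assumes "n \<ge> 2" "\<And>j. n \<noteq> triangle j"
  shows "2 dvd DE_e (n + 1) - DE_e (n - 2)"
proof -
  define K where "K = n + 2"
  define F where "F = (\<Sum>k<K. DE_e_summand k)"
  define F' where "F' = (\<Sum>k<K. fps_X ^ (2 * k) * gauss_prod k)"
  have "n + 1 < 2 * K" by (simp add: K_def)
  have shift: "Suc n - 3 = n - 2" by simp
  have "2 dvd F - F'"
    unfolding F_def F'_def sum_subtractf[symmetric] by (intro dvd_sum DE_e_summand_mod_2)
  then have "2 dvd ((1 - fps_X ^ 3) * F - (1 - fps_X ^ 3) * F') $ (n + 1)"
    by (intro even_fps_nth) (simp flip: right_diff_distrib)
  moreover have "F $ m = DE_e m" if "m \<le> n + 1" for m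
    using that unfolding F_def K_def by (intro DE_e_eq_partial_sum[symmetric]) simp
  then have "((1 - fps_X ^ 3) * F) $ (n + 1) = DE_e (n + 1) - DE_e (n - 2)"
    using assms(1) by (simp add: left_diff_distrib fps_X_power_mult_nth shift)
  moreover have "((1 - fps_X ^ 3) * F') $ (n + 1) = gauss_prod K $ n"
    unfolding F'_def telescoping_sum_DE_e using assms(1)
    by (simp add: left_diff_distrib fps_X_power_mult_nth \<open>n + 1 < 2 * K\<close>[simplified])
  moreover have "gauss_prod K $ n = 0"
    using assms(2) by (intro gauss_prod_nth_non_triangular) (auto simp: K_def)
  ultimately show ?thesis by (simp only: fps_sub_nth diff_0_right)
qed

section \<open>The generating function of DE_e1 modulo 2\<close>

definition bounded_partitions :: "nat \<Rightarrow> nat \<Rightarrow> nat multiset set" where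
  "bounded_partitions N m =
     {P. is_partition P m \<and> (\<forall>k. even k \<longrightarrow> count P k \<le> 1) \<and> (\<forall>k\<in>#P. k \<le> N)}"

definition bounded_gf :: "nat \<Rightarrow> int fps" where
  "bounded_gf N = Abs_fps (\<lambda>m. int (card (bounded_partitions N m)))"

text \<open>
  Partitions are classified by their largest part \<open>2 k + 2\<close>. As it occurs once, all other parts are
  at most \<open>2 k + 1\<close>.
\<close>
lemma DE_e1_partitions_eq:
  "DE_e1_partitions m =
     (\<Union>k\<in>{k. 2 * k + 2 \<le> m}. add_mset (2 * k + 2) ` bounded_partitions (2 * k + 1) (m - (2 * k + 2)))"
    (is "_ = ?R")
proof (intro equalityI subsetI)
  fix P assume P: "P \<in> DE_e1_partitions m"
  define M where "M = Max_mset P"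
  have M: "even M" "count P M = 1" "M \<in># P" "0 \<notin># P" "sum_mset P = m" "\<And>k. k \<in># P \<Longrightarrow> k \<le> M"
      "\<And>k. even k \<Longrightarrow> count P k \<le> 1"
    using P by (auto simp: DE_e1_partitions_def M_def is_partition_def)
  have "M \<noteq> 0" using M by metis
  with \<open>even M\<close> obtain k where k: "M = 2 * k + 2"
    by (metis add_2_eq_Suc' dvdE mult_Suc_right not0_implies_Suc mult_0_right add.commute)
  define Q where "Q = P - {#M#}"
  have PQ: "P = add_mset M Q" using M(3) by (simp add: Q_def)
  have "M \<notin># Q" using M(2) by (simp add: PQ not_in_iff)
  have "j \<le> 2 * k + 1" if "j \<in># Q" for j
  proof -
    have "j \<noteq> M" using that \<open>M \<notin># Q\<close> by auto
    moreover have "j \<le> M" using M(6)[of j] that by (simp add: PQ)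
    ultimately show ?thesis by (simp add: k)
  qed
  moreover have "count Q j \<le> 1" if "even j" for j
    using M(7)[OF that] by (simp add: PQ split: if_splits)
  ultimately have "Q \<in> bounded_partitions (2 * k + 1) (m - (2 * k + 2))"
    using M(4,5) by (auto simp: bounded_partitions_def is_partition_def PQ k)
  moreover have "2 * k + 2 \<le> m" using M(5) by (simp add: PQ k)
  ultimately show "P \<in> ?R" unfolding PQ k by blast
next
  fix P assume "P \<in> ?R"
  then obtain k Q where k: "2 * k + 2 \<le> m" and P: "P = add_mset (2 * k + 2) Q"
    and Q: "Q \<in> bounded_partitions (2 * k + 1) (m - (2 * k + 2))" by blast
  have le: "\<And>j. j \<in># Q \<Longrightarrow> j \<le> 2 * k + 1" using Q by (auto simp: bounded_partitions_def)
  then have "2 * k + 2 \<notin># Q" by fastforce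
  then have cnt: "count Q (2 * k + 2) = 0" by (simp add: not_in_iff)
  have "Max_mset P = 2 * k + 2"
    unfolding P by (rule Max_eqI) (auto dest: le)
  with Q k cnt show "P \<in> DE_e1_partitions m"
    by (auto simp: DE_e1_partitions_def bounded_partitions_def is_partition_def P)
qed

text \<open>
  Adding a large even part embeds these partitions into those counted by \<open>DE_e1\<close>, of which there
  are finitely many.
\<close>
lemma finite_bounded_partitions: "finite (bounded_partitions N m)"
proof -
  have "bounded_partitions N m \<subseteq> bounded_partitions (2 * N + 1) m"
    by (force simp: bounded_partitions_def)
  moreover have "add_mset (2 * N + 2) ` bounded_partitions (2 * N + 1) m
                 \<subseteq> DE_e1_partitions (m + (2 * N + 2))"
    unfolding DE_e1_partitions_eq by (rule order.trans[OF _ UN_upper[of N]]) simp_all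
  then have "finite (bounded_partitions (2 * N + 1) m)"
    by (rule finite_imageD[OF finite_subset[OF _ finite_DE_e1_partitions]]) (simp add: inj_on_def)
  ultimately show ?thesis by (rule finite_subset)
qed

lemma card_add_mset_image: "card (add_mset a ` S) = card S"
  by (intro card_image inj_onI) simp

lemma DE_e1_eq_partial_sum:
  assumes "m \<le> K"
  shows "int (DE_e1 m) = (\<Sum>k<K. fps_X ^ (2 * k + 2) * bounded_gf (2 * k + 1)) $ m"
proof -
  let ?A = "\<lambda>k. add_mset (2 * k + 2) ` bounded_partitions (2 * k + 1) (m - (2 * k + 2))"
  have fin: "finite {k. 2 * k + 2 \<le> m}"
    by (rule finite_subset[of _ "{..m}"]) auto
  have disj: "?A k \<inter> ?A l = {}" if "k < l" for k l
  proof -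
    have "2 * l + 2 \<notin># P" if "P \<in> ?A k" for P
      using that \<open>k < l\<close> by (fastforce simp: bounded_partitions_def)
    then show ?thesis by fastforce
  qed
  have "DE_e1 m = (\<Sum>k\<in>{k. 2 * k + 2 \<le> m}. card (?A k))"
    unfolding DE_e1_def DE_e1_partitions_eq using fin disj
    by (intro card_UN_disjoint) (auto simp: finite_bounded_partitions neq_iff Int_commute)
  also have "\<dots> = (\<Sum>k\<in>{k. 2 * k + 2 \<le> m}.
                       card (bounded_partitions (2 * k + 1) (m - (2 * k + 2))))"
    by (simp only: card_add_mset_image)
  finally have "int (DE_e1 m) = (\<Sum>k\<in>{k. 2 * k + 2 \<le> m}.
      (fps_X ^ (2 * k + 2) * bounded_gf (2 * k + 1)) $ m)"
    by (simp add: fps_X_power_mult_nth bounded_gf_def del: power_Suc)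
  also have "\<dots> = (\<Sum>k<K. (fps_X ^ (2 * k + 2) * bounded_gf (2 * k + 1)) $ m)"
    using assms by (intro sum.mono_neutral_left) (auto simp: fps_X_power_mult_nth simp del: power_Suc)
  finally show ?thesis by (simp add: fps_sum_nth)
qed

text \<open>
  A partition that uses the part \<open>N + 1\<close> loses one copy of it. What is left may contain further
  copies if \<open>N + 1\<close> is odd and none if it is even; the bound \<open>N'\<close> covers both cases at once.
\<close>
lemma card_bounded_partitions_Suc:
  assumes "odd (Suc N) \<Longrightarrow> N' = Suc N" and "even (Suc N) \<Longrightarrow> N' = N"
  shows "card (bounded_partitions (Suc N) m) = card (bounded_partitions N m)
         + (if Suc N \<le> m then card (bounded_partitions N' (m - Suc N)) else 0)"
proof -
  let ?A = "{P \<in> bounded_partitions (Suc N) m. Suc N \<in># P}"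
  let ?B = "{P \<in> bounded_partitions (Suc N) m. Suc N \<notin># P}"
  have B: "?B = bounded_partitions N m"
    by (fastforce simp: bounded_partitions_def le_Suc_eq)
  have A: "?A = (if Suc N \<le> m then add_mset (Suc N) ` bounded_partitions N' (m - Suc N) else {})"
  proof (intro equalityI subsetI)
    fix P assume P: "P \<in> ?A"
    define Q where "Q = P - {#Suc N#}"
    have PQ: "P = add_mset (Suc N) Q" using P by (simp add: Q_def)
    have cnt: "count Q j \<le> 1" if "even j" for j
    proof -
      have "count Q j \<le> count P j" by (simp add: PQ)
      also have "\<dots> \<le> 1" using P that by (simp add: bounded_partitions_def)
      finally show ?thesis .
    qed
    have "j \<le> N'" if "j \<in># Q" for j
    proof (cases "odd (Suc N)")
      case True
      then show ?thesis using P that assms(1) by (auto simp: bounded_partitions_def PQ)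
    next
      case False
      then have "count P (Suc N) \<le> 1" using P by (auto simp: bounded_partitions_def)
      then have "Suc N \<notin># Q" by (simp add: PQ not_in_iff)
      with that have "j \<noteq> Suc N" by auto
      moreover have "j \<le> Suc N" using P that by (auto simp: bounded_partitions_def PQ)
      ultimately show ?thesis using assms(2) False by simp
    qed
    with cnt P have "Q \<in> bounded_partitions N' (m - Suc N)" "Suc N \<le> m"
      by (auto simp: bounded_partitions_def is_partition_def PQ)
    then show "P \<in> (if Suc N \<le> m then add_mset (Suc N) ` bounded_partitions N' (m - Suc N) else {})"
      by (simp add: PQ)
  next
    fix P assume "P \<in> (if Suc N \<le> m then add_mset (Suc N) ` bounded_partitions N' (m - Suc N) else {})"
    then obtain Q where m: "Suc N \<le> m" and PQ: "P = add_mset (Suc N) Q"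
      and Q: "Q \<in> bounded_partitions N' (m - Suc N)" by (auto split: if_splits)
    have N': "N' \<le> Suc N" using assms by (cases "odd (Suc N)") auto
    have cnt: "count P j \<le> 1" if "even j" for j
    proof (cases "j = Suc N")
      case True
      then have "N' = N" using assms(2) that by simp
      then have "Suc N \<notin># Q" using Q by (auto simp: bounded_partitions_def)
      then show ?thesis by (simp add: True PQ not_in_iff)
    next
      case False
      then show ?thesis using Q that by (simp add: PQ bounded_partitions_def)
    qed
    have "j \<le> Suc N" if "j \<in># P" for j
    proof -
      have "j = Suc N \<or> j \<in># Q" using that by (auto simp: PQ)
      moreover have "j \<le> N'" if "j \<in># Q" using that Q by (simp add: bounded_partitions_def)
      ultimately show ?thesis using N' by auto
    qed
    with cnt Q m show "P \<in> ?A"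
      by (auto simp: bounded_partitions_def is_partition_def PQ)
  qed
  have "bounded_partitions (Suc N) m = ?B \<union> ?A" by auto
  then have "card (bounded_partitions (Suc N) m) = card ?B + card ?A"
    using finite_bounded_partitions[of "Suc N" m] by (metis (no_types, lifting) card_Un_disjoint
      disjoint_iff finite_Un mem_Collect_eq)
  also have "card ?A = (if Suc N \<le> m then card (bounded_partitions N' (m - Suc N)) else 0)"
    unfolding A by (simp add: card_add_mset_image)
  finally show ?thesis unfolding B .
qed

lemma bounded_gf_Suc:
  assumes "odd (Suc N) \<Longrightarrow> N' = Suc N" and "even (Suc N) \<Longrightarrow> N' = N"
  shows "bounded_gf (Suc N) = bounded_gf N + fps_X ^ Suc N * bounded_gf N'"
proof (rule fps_ext)
  fix m
  have "card (bounded_partitions (Suc N) m) = card (bounded_partitions N m)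
         + (if Suc N \<le> m then card (bounded_partitions N' (m - Suc N)) else 0)"
    using assms by (rule card_bounded_partitions_Suc)
  then show "bounded_gf (Suc N) $ m = (bounded_gf N + fps_X ^ Suc N * bounded_gf N') $ m"
    by (simp add: bounded_gf_def fps_X_power_mult_nth del: power_Suc)
qed

lemma bounded_gf_0: "bounded_gf 0 = 1"
proof (rule fps_ext)
  fix m
  have "bounded_partitions 0 m = (if m = 0 then {{#}} else {})"
  proof -
    have "P = {#}" if "P \<in> bounded_partitions 0 m" for P
      using that by (cases P) (auto simp: bounded_partitions_def is_partition_def)
    moreover have "{#} \<in> bounded_partitions 0 m \<longleftrightarrow> m = 0"
      by (auto simp: bounded_partitions_def is_partition_def)
    ultimately show ?thesis by auto
  qed
  then show "bounded_gf 0 $ m = 1 $ m" by (simp add: bounded_gf_def)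
qed

text \<open>
  Admitting the odd part \<open>2 k + 1\<close> divides the generating function by \<open>1 - q^(2k+1)\<close>, and admitting
  the even part \<open>2 k + 2\<close> multiplies it by \<open>1 + q^(2k+2)\<close>.
\<close>
lemma bounded_gf_even:
  "bounded_gf (2 * k) = qpoch (- (fps_X ^ 2)) (fps_X ^ 2) k * (\<Prod>j<k. odd_inv j)"
  and bounded_gf_odd: "bounded_gf (2 * k + 1) = bounded_gf (2 * k) * odd_inv k"
proof -
  have odd_step: "bounded_gf (2 * k + 1) = bounded_gf (2 * k) * odd_inv k" for k
  proof -
    have "bounded_gf (2 * k + 1) = bounded_gf (2 * k) + fps_X ^ (2 * k + 1) * bounded_gf (2 * k + 1)"
      using bounded_gf_Suc[of "2 * k" "2 * k + 1"] by simp
    then have step: "bounded_gf (2 * k + 1) * (1 - fps_X ^ (2 * k + 1)) = bounded_gf (2 * k)"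
      by (simp add: algebra_simps)
    have "bounded_gf (2 * k + 1) = bounded_gf (2 * k + 1) * ((1 - fps_X ^ (2 * k + 1)) * odd_inv k)"
      by (simp only: odd_inv mult_1_right)
    then show ?thesis
      by (simp only: step mult.assoc[symmetric])
  qed
  then show "bounded_gf (2 * k + 1) = bounded_gf (2 * k) * odd_inv k" .
  show "bounded_gf (2 * k) = qpoch (- (fps_X ^ 2)) (fps_X ^ 2) k * (\<Prod>j<k. odd_inv j)"
  proof (induction k)
    case 0
    then show ?case by (simp add: bounded_gf_0 qpoch_def)
  next
    case (Suc k)
    have power: "fps_X ^ Suc (2 * k + 1) = fps_X ^ 2 * (fps_X ^ 2 :: int fps) ^ k"
      by (simp add: power2_eq_square power_mult)
    have "bounded_gf (2 * Suc k) = bounded_gf (2 * k + 1) * (1 + fps_X ^ 2 * (fps_X ^ 2) ^ k)"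
      using bounded_gf_Suc[of "2 * k + 1" "2 * k + 1"]
      unfolding power by (simp add: algebra_simps)
    then show ?case
      unfolding odd_step Suc.IH qpoch_def prod.lessThan_Suc by (simp add: mult_ac)
  qed
qed

lemma bounded_gf_mod_2: "2 dvd bounded_gf (2 * k + 1) - gauss_prod k * odd_inv k"
proof -
  have "bounded_gf (2 * k + 1) - gauss_prod k * odd_inv k
     = (qpoch (- (fps_X ^ 2)) (fps_X ^ 2) k - qpoch (fps_X ^ 2) (fps_X ^ 2) k)
         * ((\<Prod>j<k. odd_inv j) * odd_inv k)"
    unfolding bounded_gf_odd bounded_gf_even gauss_prod_qpoch by (simp only: algebra_simps)
  then show ?thesis using qpoch_sign_mod_2 by simp
qed

text \<open>
  The coefficient of \<open>q^(n+1)\<close> in \<open>(1 - q) * \<Sum>m. DE_e1 m * q^m\<close>. The term \<open>-q\<close> of the telescoped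
  sum does not reach it: \<open>n\<close> is positive because 0 is triangular.
\<close>
lemma DE_e1_shift_mod_2:
  assumes "\<And>j. n \<noteq> triangle j"
  shows "2 dvd int (DE_e1 (n + 1)) - int (DE_e1 n)"
proof -
  define K where "K = n + 1"
  define G where "G = (\<Sum>k<K. fps_X ^ (2 * k + 2) * bounded_gf (2 * k + 1))"
  define G' where "G' = (\<Sum>k<K. fps_X ^ (2 * k + 2) * (gauss_prod k * odd_inv k))"
  have "n \<noteq> 0" using assms[of 0] by simp
  have "2 dvd G - G'"
    unfolding G_def G'_def sum_subtractf[symmetric] right_diff_distrib[symmetric]
    by (intro dvd_sum dvd_mult bounded_gf_mod_2)
  then have "2 dvd ((1 - fps_X) * G - (1 - fps_X) * G') $ (n + 1)"
    by (intro even_fps_nth) (simp flip: right_diff_distrib)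
  moreover have "((1 - fps_X) * G) $ (n + 1) = int (DE_e1 (n + 1)) - int (DE_e1 n)"
    by (simp add: G_def K_def DE_e1_eq_partial_sum[of _ "n + 1"] left_diff_distrib
          del: sum.lessThan_Suc)
  moreover have "((1 - fps_X) * G') $ (n + 1) = gauss_prod K $ n"
    unfolding G'_def telescoping_sum_DE_e1 using \<open>n \<noteq> 0\<close> by simp
  moreover have "gauss_prod K $ n = 0"
    using assms by (intro gauss_prod_nth_non_triangular) (auto simp: K_def)
  ultimately show ?thesis by (simp only: fps_sub_nth diff_0_right)
qed

section \<open>The congruences\<close>

theorem theorem9:
  shows "(\<forall>n::nat. n \<ge> 2 \<and> (\<forall>j::nat. n \<noteq> triangle j) \<longrightarrow>
      [(\<Sum>j\<in>{j::int. 2 * j\<^sup>2 + 2 \<le> int n}. DE_e (nat (int n - 2 * j\<^sup>2 - 2)))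
       = (\<Sum>j\<in>{j::int. 2 * j\<^sup>2 + 2 \<le> int n}. DE_e (nat (int n - 2 * j\<^sup>2 + 1)))] (mod 2))
    \<and>
    (\<forall>n::nat. (\<forall>j::nat. n \<noteq> triangle j) \<longrightarrow>
      [(\<Sum>j\<in>{j::int. 2 * j\<^sup>2 \<le> int n}. DE_e1 (nat (int n - 2 * j\<^sup>2 + 1)))
       = (\<Sum>j\<in>{j::int. 2 * j\<^sup>2 \<le> int n}. DE_e1 (nat (int n - 2 * j\<^sup>2)))] (mod 2))"
proof (intro conjI allI impI)
  fix n :: nat assume n: "n \<ge> 2 \<and> (\<forall>j. n \<noteq> triangle j)"
  let ?S = "{j::int. 2 * j\<^sup>2 + 2 \<le> int n}"
  have nat_n: "nat (int n - 2) = n - 2" "nat (int n + 1) = n + 1" by simp_all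
  have S: "finite ?S" "0 \<in> ?S" "\<And>j. j \<in> ?S \<Longrightarrow> - j \<in> ?S"
    using n finite_int_double_square_le[of 2 "int n"] by simp_all
  obtain c where c: "(\<Sum>j\<in>?S. DE_e (nat (int n - 2 * j\<^sup>2 - 2))) = DE_e (n - 2) + 2 * c"
    using sum_symmetric_even_function[OF S, of "\<lambda>j. DE_e (nat (int n - 2 * j\<^sup>2 - 2))"]
    by (auto simp: nat_n)
  obtain d where d: "(\<Sum>j\<in>?S. DE_e (nat (int n - 2 * j\<^sup>2 + 1))) = DE_e (n + 1) + 2 * d"
    using sum_symmetric_even_function[OF S, of "\<lambda>j. DE_e (nat (int n - 2 * j\<^sup>2 + 1))"]
    by (auto simp: nat_n)
  have "2 dvd DE_e (n + 1) - DE_e (n - 2)"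
    using n by (intro DE_e_shift_mod_2) auto
  then show "[(\<Sum>j\<in>?S. DE_e (nat (int n - 2 * j\<^sup>2 - 2)))
       = (\<Sum>j\<in>?S. DE_e (nat (int n - 2 * j\<^sup>2 + 1)))] (mod 2)"
    unfolding c d cong_iff_dvd_diff by (simp add: algebra_simps)
next
  fix n :: nat assume n: "\<forall>j. n \<noteq> triangle j"
  let ?S = "{j::int. 2 * j\<^sup>2 \<le> int n}"
  have nat_n: "nat (int n + 1) = n + 1" by simp
  have S: "finite ?S" "0 \<in> ?S" "\<And>j. j \<in> ?S \<Longrightarrow> - j \<in> ?S"
    using finite_int_double_square_le[of 0 "int n"] by simp_all
  obtain c where c: "(\<Sum>j\<in>?S. DE_e1 (nat (int n - 2 * j\<^sup>2 + 1))) = DE_e1 (n + 1) + 2 * c"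
    using sum_symmetric_even_function[OF S, of "\<lambda>j. DE_e1 (nat (int n - 2 * j\<^sup>2 + 1))"]
    by (auto simp: nat_n)
  obtain d where d: "(\<Sum>j\<in>?S. DE_e1 (nat (int n - 2 * j\<^sup>2))) = DE_e1 n + 2 * d"
    using sum_symmetric_even_function[OF S, of "\<lambda>j. DE_e1 (nat (int n - 2 * j\<^sup>2))"]
    by auto
  have "2 dvd int (DE_e1 (n + 1)) - int (DE_e1 n)"
    using n by (intro DE_e1_shift_mod_2) auto
  then show "[(\<Sum>j\<in>?S. DE_e1 (nat (int n - 2 * j\<^sup>2 + 1)))
       = (\<Sum>j\<in>?S. DE_e1 (nat (int n - 2 * j\<^sup>2)))] (mod 2)"
    unfolding c d cong_int_iff[symmetric] cong_iff_dvd_diff by (simp add: algebra_simps)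
qed

end
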